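(* There is no bribeproof mechanism for the path auction problem on general networks and certain heterogeneous two-values domains. That is: there exist a network and, for each agent $i$, reals $L_i<H_i$, such that for the domain $\Theta_i=\{L_i,H_i\}$ ($i\in N$) no mechanism $(A,p)$ whose algorithm $A$ always selects a minimum-cost $s$–$t$ path is bribeproof.
   Context: Path auction: a network is a finite graph with two distinguished nodes $s,t$ joined by at least one path; each edge is owned by a distinct agent, $N=\{1,\dots,n\}$, $n\ge2$. A feasible allocation is the $0/1$ indicator vector of the edges of a (simple) $s$–$t$ path: each agent on the selected path gets one unit of work, all others get zero. Agent $i$ has private type $\theta_i\in\Theta_i$, the cost of her edge. $\Theta=\Theta_1\times\cdots\times\Theta_n$. A mechanism is a pair $(A,p)$ where $A:\Theta\to\mathcal{A}$ maps reported types to a feasible allocation and $p:\Theta\to\mathbb{R}^n$ gives payments to agents; the algorithm selects a path minimizing $\sum_i A_i(\theta)\theta_i$ for every $\theta$ (ties broken arbitrarily). $(A,p)$ is bribeproof if for all $\theta\in\Theta$, all $i,j\in N$ and all $\hat\theta_i\in\Theta_i$, with $\hat\theta$ denoting $\theta$ with its $i$-th entry replaced by $\hat\theta_i$: if $i\neq j$, $p_i(\theta)-A_i(\theta)\theta_i+p_j(\theta)-A_j(\theta)\theta_j\ge p_i(\hat\theta)-A_i(\hat\theta)\theta_i+p_j(\hat\theta)-A_j(\hat\theta)\theta_j$; and, for $i=j$, $p_i(\theta)-A_i(\theta)\theta_i\ge p_i(\hat\theta)-A_i(\hat\theta)\theta_i$. *)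

theory Defs
  imports Complex_Main "HOL-Library.FuncSet"
begin

text \<open>
  A network is a finite simple undirected graph on the vertex set \<open>V\<close>. Its edges are indexed by
  the agents \<open>{1..n}\<close> that own them: \<open>ends i\<close> is the set of the two endpoints of agent \<open>i\<close>'s edge.
\<close>

definition steps :: "'v list \<Rightarrow> 'v set set" where
  "steps vs = {{vs ! k, vs ! Suc k} | k. Suc k < length vs}"

definition simple_path :: "'v set \<Rightarrow> nat \<Rightarrow> (nat \<Rightarrow> 'v set) \<Rightarrow> 'v \<Rightarrow> 'v \<Rightarrow> 'v list \<Rightarrow> bool" where
  "simple_path V n ends s t vs \<longleftrightarrow>
     vs \<noteq> [] \<and> hd vs = s \<and> last vs = t \<and> distinct vs \<and> set vs \<subseteq> V \<and> steps vs \<subseteq> ends ` {1..n}"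

definition network :: "'v set \<Rightarrow> nat \<Rightarrow> (nat \<Rightarrow> 'v set) \<Rightarrow> 'v \<Rightarrow> 'v \<Rightarrow> bool" where
  "network V n ends s t \<longleftrightarrow>
     finite V \<and> n \<ge> 2 \<and> s \<in> V \<and> t \<in> V \<and> s \<noteq> t \<and>
     (\<forall>i\<in>{1..n}. ends i \<subseteq> V \<and> card (ends i) = 2) \<and> inj_on ends {1..n} \<and>
     (\<exists>vs. simple_path V n ends s t vs)"

text \<open>
  Vectors indexed by the agents (allocations, type profiles) are extensional functions on \<open>{1..n}\<close>.
\<close>

definition path_allocations ::
    "'v set \<Rightarrow> nat \<Rightarrow> (nat \<Rightarrow> 'v set) \<Rightarrow> 'v \<Rightarrow> 'v \<Rightarrow> (nat \<Rightarrow> real) set" where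
  "path_allocations V n ends s t =
     {(\<lambda>i\<in>{1..n}. if ends i \<in> steps vs then 1 else 0) | vs. simple_path V n ends s t vs}"

definition profiles :: "nat \<Rightarrow> (nat \<Rightarrow> real set) \<Rightarrow> (nat \<Rightarrow> real) set" where
  "profiles n D = PiE {1..n} D"

definition social_cost :: "nat \<Rightarrow> (nat \<Rightarrow> real) \<Rightarrow> (nat \<Rightarrow> real) \<Rightarrow> real" where
  "social_cost n a \<theta> = (\<Sum>i\<in>{1..n}. a i * \<theta> i)"

definition min_cost_algorithm ::
    "nat \<Rightarrow> (nat \<Rightarrow> real set) \<Rightarrow> (nat \<Rightarrow> real) set \<Rightarrow> ((nat \<Rightarrow> real) \<Rightarrow> nat \<Rightarrow> real) \<Rightarrow> bool" where
  "min_cost_algorithm n D F A \<longleftrightarrow>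
     (\<forall>\<theta>\<in>profiles n D. A \<theta> \<in> F \<and> (\<forall>a\<in>F. social_cost n (A \<theta>) \<theta> \<le> social_cost n a \<theta>))"

text \<open>
  Utility of agent \<open>i\<close> at true type profile \<open>\<theta>\<close> when the reported profile is \<open>r\<close>.
\<close>

definition utility ::
    "((nat \<Rightarrow> real) \<Rightarrow> nat \<Rightarrow> real) \<Rightarrow> ((nat \<Rightarrow> real) \<Rightarrow> nat \<Rightarrow> real) \<Rightarrow>
     (nat \<Rightarrow> real) \<Rightarrow> (nat \<Rightarrow> real) \<Rightarrow> nat \<Rightarrow> real" where
  "utility A p \<theta> r i = p r i - A r i * \<theta> i"

definition bribeproof ::
    "nat \<Rightarrow> (nat \<Rightarrow> real set) \<Rightarrow>
     ((nat \<Rightarrow> real) \<Rightarrow> nat \<Rightarrow> real) \<Rightarrow> ((nat \<Rightarrow> real) \<Rightarrow> nat \<Rightarrow> real) \<Rightarrow> bool" where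
  "bribeproof n D A p \<longleftrightarrow>
     (\<forall>\<theta>\<in>profiles n D. \<forall>i\<in>{1..n}. \<forall>j\<in>{1..n}. \<forall>x\<in>D i.
        (i \<noteq> j \<longrightarrow>
           utility A p \<theta> \<theta> i + utility A p \<theta> \<theta> j
             \<ge> utility A p \<theta> (\<theta>(i := x)) i + utility A p \<theta> (\<theta>(i := x)) j) \<and>
        (i = j \<longrightarrow> utility A p \<theta> \<theta> i \<ge> utility A p \<theta> (\<theta>(i := x)) i))"

end

theory Submission
  imports Defs
begin

text \<open>
  The network is a cycle in which agent 1's edge joins \<open>s\<close> to \<open>t\<close> directly and agents 2, 3, 4 own
  the other route. Bribeproofness forces the utility of every agent \<open>j\<close> to change by at most
  \<open>H i - L i\<close> when agent \<open>i \<noteq> j\<close> changes her type, and not at all if \<open>i\<close>'s work is unaffected.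
  Raise the types of agents 2, 3, 4 one after the other. The optimum moves to agent 1's edge at the
  first step if agent 1 has low cost and only at the last step if she has high cost, so in both
  cases her utility changes in just one step. Her gain from being of low type must therefore rise
  from 0 (never selected) to \<open>H 1 - L 1\<close> (always selected) while changing by at most twice
  \<open>H 2 - L 2\<close>; this fails once \<open>H 1 - L 1\<close> is larger, which three agents leave room for.
\<close>

lemma steps_Cons_Cons: "steps (a # b # vs) = insert {a, b} (steps (b # vs))"
proof
  show "steps (a # b # vs) \<subseteq> insert {a, b} (steps (b # vs))"
  proof
    fix e assume "e \<in> steps (a # b # vs)"
    then obtain k where k: "Suc k < length (a # b # vs)"
      "e = {(a # b # vs) ! k, (a # b # vs) ! Suc k}"
      unfolding steps_def by blast
    show "e \<in> insert {a, b} (steps (b # vs))"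
    proof (cases k)
      case (Suc m)
      then show ?thesis using k unfolding steps_def by auto
    qed (use k in simp)
  qed
  have "{a, b} \<in> steps (a # b # vs)"
    unfolding steps_def by (intro CollectI exI[of _ 0]) simp
  moreover have "steps (b # vs) \<subseteq> steps (a # b # vs)"
  proof
    fix e assume "e \<in> steps (b # vs)"
    then obtain k where "Suc k < length (b # vs)" "e = {(b # vs) ! k, (b # vs) ! Suc k}"
      unfolding steps_def by blast
    then show "e \<in> steps (a # b # vs)"
      unfolding steps_def by (intro CollectI exI[of _ "Suc k"]) simp
  qed
  ultimately show "insert {a, b} (steps (b # vs)) \<subseteq> steps (a # b # vs)" by simp
qed

lemma steps_singleton: "steps [a] = {}"
  by (simp add: steps_def)

text \<open>Agent \<open>j\<close> has the same type in both profiles, so the pair conditions at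
  \<theta> and \<theta>' place her utility difference between \<open>q + d * \<theta> i\<close> and
  \<open>q + d * x\<close>, where \<open>q = p \<theta>' i - p \<theta> i\<close> and
  \<open>d = A \<theta> i - A \<theta>' i\<close>. Truthfulness of \<open>i\<close> makes the lower
  end nonpositive and the upper end nonnegative. The interval thus contains both 0 and the
  difference, and its length is the bound. If \<open>d = 0\<close>, both ends equal
  \<open>q\<close>, which forces \<open>q = 0\<close>.\<close>

lemma bribeproof_utility_bound:
  assumes "bribeproof n D A p" "\<theta> \<in> profiles n D" "i \<in> {1..n}" "j \<in> {1..n}" "i \<noteq> j" "x \<in> D i"
  defines "\<theta>' \<equiv> \<theta>(i := x)"
  shows "\<bar>utility A p \<theta> \<theta> j - utility A p \<theta>' \<theta>' j\<bar> \<le> (A \<theta> i - A \<theta>' i) * (x - \<theta> i)"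
    and "A \<theta> i = A \<theta>' i \<Longrightarrow> p \<theta> i = p \<theta>' i"
proof -
  have dev: "\<theta>' \<in> profiles n D"
    using assms by (auto simp: profiles_def PiE_iff extensional_def)
  have revert: "\<theta>'(i := \<theta> i) = \<theta>" by (simp add: \<theta>'_def)
  have true_type: "\<theta> i \<in> D i" using assms by (auto simp: profiles_def)
  note b = assms(1)[unfolded bribeproof_def, rule_format]
  have "utility A p \<theta> \<theta> i \<ge> utility A p \<theta> \<theta>' i"
    "utility A p \<theta> \<theta> i + utility A p \<theta> \<theta> j \<ge> utility A p \<theta> \<theta>' i + utility A p \<theta> \<theta>' j"
    using b[OF assms(2,3,3,6)] b[OF assms(2,3,4,6)] assms(5) by (auto simp: \<theta>'_def)
  \<comment> \<open>The reverse deviation: \<theta>' is now the truth and \<theta> the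
    report.\<close>
  moreover have "utility A p \<theta>' \<theta>' i \<ge> utility A p \<theta>' \<theta> i"
    "utility A p \<theta>' \<theta>' i + utility A p \<theta>' \<theta>' j \<ge> utility A p \<theta>' \<theta> i + utility A p \<theta>' \<theta> j"
    using b[OF dev assms(3,3) true_type] b[OF dev assms(3,4) true_type] assms(5) by (auto simp: revert)
  moreover have "\<theta>' i = x" "\<theta>' j = \<theta> j" using assms(5) by (auto simp: \<theta>'_def)
  ultimately show "\<bar>utility A p \<theta> \<theta> j - utility A p \<theta>' \<theta>' j\<bar> \<le> (A \<theta> i - A \<theta>' i) * (x - \<theta> i)"
    and "A \<theta> i = A \<theta>' i \<Longrightarrow> p \<theta> i = p \<theta>' i"
    by (auto simp: utility_def algebra_simps)
qed

definition cycle_ends :: "nat \<Rightarrow> nat set" where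
  "cycle_ends i = (if i = 1 then {0, 1} else if i = 2 then {0, 2} else if i = 3 then {2, 3} else {3, 1})"

text \<open>One encoding serves both type profiles and allocations.\<close>

definition profile4 :: "real \<Rightarrow> real \<Rightarrow> real \<Rightarrow> real \<Rightarrow> nat \<Rightarrow> real" where
  "profile4 a b c d = (\<lambda>i\<in>{1..4}. if i = 1 then a else if i = 2 then b else if i = 3 then c else d)"

lemma atLeastAtMost_1_4: "{1..4::nat} = {1, 2, 3, 4}"
  by auto

lemma profile4_simps [simp]:
  "profile4 a b c d (Suc 0) = a" "profile4 a b c d 2 = b"
  "profile4 a b c d 3 = c" "profile4 a b c d 4 = d"
  by (simp_all add: profile4_def)

lemma profile4_upd:
  "(profile4 a b c d)(1 := x) = profile4 x b c d"
  "(profile4 a b c d)(2 := x) = profile4 a x c d"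
  "(profile4 a b c d)(3 := x) = profile4 a b x d"
  "(profile4 a b c d)(4 := x) = profile4 a b c x"
  by (auto simp: profile4_def fun_eq_iff)

lemma social_cost_profile4:
  "social_cost 4 (profile4 w x y z) (profile4 a b c d) = w * a + x * b + y * c + z * d"
  unfolding social_cost_def atLeastAtMost_1_4 by simp

text \<open>Only the first step out of 0 is a choice; afterwards distinctness forces each next
  vertex until 1 is reached.\<close>

lemma simple_path_cycle_iff:
  "simple_path {0..3} 4 cycle_ends 0 1 vs \<longleftrightarrow> vs = [0, 1] \<or> vs = [0, 2, 3, 1]"
proof
  have edges: "cycle_ends ` {1..4} = {{0, 1}, {0, 2}, {2, 3}, {3, 1}}"
    unfolding atLeastAtMost_1_4 by (auto simp: cycle_ends_def)
  show "simple_path {0..3} 4 cycle_ends 0 1 vs" if "vs = [0, 1] \<or> vs = [0, 2, 3, 1]"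
    using that
    by (auto simp: simple_path_def edges[simplified] steps_Cons_Cons steps_singleton)
  assume path: "simple_path {0..3} 4 cycle_ends 0 1 vs"
  note p = path[unfolded simple_path_def edges]
  then obtain b xs where vs: "vs = 0 # b # xs"
    by (cases vs; cases "tl vs") auto
  with p have "b = 1 \<or> b = 2"
    by (auto simp: steps_Cons_Cons doubleton_eq_iff)
  then show "vs = [0, 1] \<or> vs = [0, 2, 3, 1]"
  proof
    assume "b = 1"
    \<comment> \<open>A nonempty \<open>xs\<close> would end in 1 and so repeat that vertex.\<close>
    with p vs show ?thesis by (cases xs rule: rev_cases) auto
  next
    assume b: "b = 2"
    with p vs obtain c ys where xs: "xs = c # ys" by (cases xs) auto
    with p vs b have c: "c = 3"
      by (auto simp: steps_Cons_Cons doubleton_eq_iff)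
    with p vs b xs obtain d zs where ys: "ys = d # zs" by (cases ys) auto
    with p vs b xs c have d: "d = 1"
      by (auto simp: steps_Cons_Cons doubleton_eq_iff)
    with p vs b xs c ys show ?thesis by (cases zs rule: rev_cases) auto
  qed
qed

lemma path_allocations_cycle:
  "path_allocations {0..3} 4 cycle_ends 0 1 = {profile4 1 0 0 0, profile4 0 1 1 1}"
proof -
  have "path_allocations {0..3} 4 cycle_ends 0 1
      = (\<lambda>vs. \<lambda>i\<in>{1..4}. if cycle_ends i \<in> steps vs then 1 else 0) ` {[0, 1], [0, 2, 3, 1]}"
    unfolding path_allocations_def simple_path_cycle_iff by auto
  moreover have "(\<lambda>i\<in>{1..4}. if cycle_ends i \<in> steps [0, 1] then 1 else 0) = profile4 1 0 0 0"
    by (auto simp: fun_eq_iff profile4_def cycle_ends_def steps_Cons_Cons steps_singleton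
        doubleton_eq_iff)
  moreover have "(\<lambda>i\<in>{1..4}. if cycle_ends i \<in> steps [0, 2, 3, 1] then 1 else 0) = profile4 0 1 1 1"
    by (auto simp: fun_eq_iff profile4_def cycle_ends_def steps_Cons_Cons steps_singleton
        doubleton_eq_iff)
  ultimately show ?thesis by simp
qed

lemma network_cycle: "network {0..3} 4 cycle_ends 0 1"
  unfolding network_def simple_path_cycle_iff
  by (auto simp: atLeastAtMost_1_4 cycle_ends_def inj_on_def doubleton_eq_iff)

text \<open>The detour costs 12, 16, 20 or 24. As 12 < 13 < 16 and 20 < 23 < 24, no ties occur and
  the two switches happen at opposite ends of the chain; moreover 23 - 13 = 10 exceeds 4 +
  4.\<close>

lemma no_bribeproof_min_cost_cycle:
  fixes L H :: "nat \<Rightarrow> real"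
  defines "L \<equiv> \<lambda>i. if i = 1 then 13 else 4" and "H \<equiv> \<lambda>i. if i = 1 then 23 else 8"
  assumes opt: "min_cost_algorithm 4 (\<lambda>i. {L i, H i}) {profile4 1 0 0 0, profile4 0 1 1 1} A"
  shows "\<not> bribeproof 4 (\<lambda>i. {L i, H i}) A p"
proof
  assume bp: "bribeproof 4 (\<lambda>i. {L i, H i}) A p"
  have prof: "profile4 a b c d \<in> profiles 4 (\<lambda>i. {L i, H i})"
    if "a \<in> {13, 23}" "b \<in> {4, 8}" "c \<in> {4, 8}" "d \<in> {4, 8}" for a b c d
    using that by (auto simp: profiles_def PiE_iff profile4_def L_def H_def)
  have direct: "A (profile4 a b c d) = profile4 1 0 0 0"
    if "a \<in> {13, 23}" "b \<in> {4, 8}" "c \<in> {4, 8}" "d \<in> {4, 8}" "a < b + c + d" for a b c d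
    using opt[unfolded min_cost_algorithm_def, rule_format, OF prof, OF that(1-4)] that(5)
    by (auto simp: social_cost_profile4)
  have detour: "A (profile4 a b c d) = profile4 0 1 1 1"
    if "a \<in> {13, 23}" "b \<in> {4, 8}" "c \<in> {4, 8}" "d \<in> {4, 8}" "a > b + c + d" for a b c d
    using opt[unfolded min_cost_algorithm_def, rule_format, OF prof, OF that(1-4)] that(5)
    by (auto simp: social_cost_profile4)
  define u where "u a b c d = utility A p (profile4 a b c d) (profile4 a b c d) 1" for a b c d
  note bound = bribeproof_utility_bound[OF bp prof]
  \<comment> \<open>Agent 1 is idle under both reports. Index 2 is merely some \<open>j\<close>
    different from 1.\<close>
  have "p (profile4 13 4 4 4) 1 = p (profile4 23 4 4 4) 1"
    using bound(2)[of 13 4 4 4 1 2 23] by (simp add: profile4_upd[simplified] detour L_def H_def)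
  then have "u 13 4 4 4 = u 23 4 4 4"
    by (simp add: u_def utility_def detour)
  \<comment> \<open>Here agent 1 works under both reports, so equal payments leave a utility gap
    equal to the cost difference 10.\<close>
  moreover have "p (profile4 13 8 8 8) 1 = p (profile4 23 8 8 8) 1"
    using bound(2)[of 13 8 8 8 1 2 23] by (simp add: profile4_upd[simplified] direct L_def H_def)
  then have "u 13 8 8 8 = u 23 8 8 8 + 10"
    by (simp add: u_def utility_def direct)
  moreover have "\<bar>u 13 4 4 4 - u 13 8 4 4\<bar> \<le> 4"
    using bound(1)[of 13 4 4 4 2 1 8] by (simp add: u_def profile4_upd direct detour L_def H_def)
  \<comment> \<open>With no switch of path the bound is 0, hence equality.\<close>
  moreover have "u 13 8 4 4 = u 13 8 8 4"
    using bound(1)[of 13 8 4 4 3 1 8] by (simp add: u_def profile4_upd direct L_def H_def)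
  moreover have "u 13 8 8 4 = u 13 8 8 8"
    using bound(1)[of 13 8 8 4 4 1 8] by (simp add: u_def profile4_upd direct L_def H_def)
  moreover have "u 23 4 4 4 = u 23 8 4 4"
    using bound(1)[of 23 4 4 4 2 1 8] by (simp add: u_def profile4_upd detour L_def H_def)
  moreover have "u 23 8 4 4 = u 23 8 8 4"
    using bound(1)[of 23 8 4 4 3 1 8] by (simp add: u_def profile4_upd detour L_def H_def)
  moreover have "\<bar>u 23 8 8 4 - u 23 8 8 8\<bar> \<le> 4"
    using bound(1)[of 23 8 8 4 4 1 8] by (simp add: u_def profile4_upd direct detour L_def H_def)
  \<comment> \<open>The gap between the \<open>u 13\<close> and \<open>u 23\<close> values would
    have to grow from 0 to 10 with a total change of at most 8.\<close>
  ultimately show False by linarith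
qed

theorem corollary18:
  shows "\<exists>(V :: nat set) (n :: nat) (ends :: nat \<Rightarrow> nat set) (s :: nat) (t :: nat)
            (L :: nat \<Rightarrow> real) (H :: nat \<Rightarrow> real).
          network V n ends s t \<and>
          (\<forall>i\<in>{1..n}. L i < H i) \<and>
          \<not> (\<exists>A p. min_cost_algorithm n (\<lambda>i. {L i, H i}) (path_allocations V n ends s t) A \<and>
                    bribeproof n (\<lambda>i. {L i, H i}) A p)"
proof (intro exI conjI)
  let ?L = "\<lambda>i. if i = 1 then 13 else 4 :: real" and ?H = "\<lambda>i. if i = 1 then 23 else 8 :: real"
  show "network {0..3} 4 cycle_ends 0 1" by (rule network_cycle)
  show "\<forall>i\<in>{1..4}. ?L i < ?H i" by simp
  show "\<not> (\<exists>A p. min_cost_algorithm 4 (\<lambda>i. {?L i, ?H i})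
                    (path_allocations {0..3} 4 cycle_ends 0 1) A \<and>
                  bribeproof 4 (\<lambda>i. {?L i, ?H i}) A p)"
    using no_bribeproof_min_cost_cycle unfolding path_allocations_cycle by blast
qed

end
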